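(* Let $n\ge1$, $N\ge 0$, and let $a_{ij}(t)$, $i\in\{1,\dots,n\}$, $j\in\{0,\dots,N\}$, be a solution of the system of ordinary differential equations $$a_{ij}'=\sum_{l,m=1}^n\sum_{p,q=0}^N T_{ilmj}^{pq}\,a_{lp}a_{mq}-C(\{a_{ij}\})\,a_{ij}\sum_{l=1}^n\sum_{q=0}^N M_{ijlq}\,a_{lq},\qquad i\in\{1,\dots,n\},\ j\in\{0,\dots,N\},$$ with initial values $a_{ij}(0)=f_i^0(x_j^i)$ for some $f_i^0\in L^1(D_i)$, where $$T_{ilmj}^{pq}=\int_{D_l}\int_{D_m}\eta_{lm}(x,y)\,T_{lm}^i(x,y,x_j^i)\,B_p^l(x)B_q^m(y)\,dx\,dy,\qquad M_{ijlq}=\int_{D_l}\eta_{il}(x_j^i,y)\,B_q^l(y)\,dy,$$ $$C(\{a_{ij}\})=\frac{\sum_{i=1}^n\sum_{j=0}^N w_{ij}\sum_{l,m=1}^n\sum_{p,q=0}^N T_{ilmj}^{pq}\,a_{lp}a_{mq}}{\sum_{i=1}^n\sum_{j=0}^N a_{ij}w_{ij}\sum_{l=1}^n\sum_{q=0}^N M_{ijlq}\,a_{lq}},\qquad w_{ij}=\int_{D_i}B_j^i(u)\,du,$$ and the denominator of $C(\{a_{ij}\})$ is nonzero along the solution. Define the discrete mass functional $$\mathcal{M}(\{a\})(t)=\sum_{i=1}^n\sum_{j=0}^N a_{ij}(t)\,w_{ij}.$$ Then the scheme numerically preserves the mass: $$\frac{d}{dt}\mathcal{M}(\{a\})(t)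=0.$$
   Context: For each $i\in\{1,\dots,n\}$, $D_i\subset\mathbb{R}^+$ is an interval (microstate domain of subsystem $i$), $\{x_j^i\}_{j=0}^N$ are distinct collocation points in $D_i$, and $\{B_j^i\}_{j=0}^N$ is the corresponding Lagrange interpolation basis of polynomials of degree $\le N$, so $B_j^i(x_k^i)=1$ if $j=k$ and $0$ otherwise. The functions $\eta_{lm}:D_l\times D_m\to\mathbb{R}$ are non-negative bounded encounter rates, and $T_{lm}^i(x,y,u)$, for $x\in D_l$, $y\in D_m$, $u\in D_i$, are transition rates (possibly of Dirac type $\delta_{\phi(x,y)-u}$, in which case the integrals defining $T_{ilmj}^{pq}$ are understood in the distributional sense). The coefficients $T_{ilmj}^{pq}$, $M_{ijlq}$, $w_{ij}$ are time-independent real numbers. The system is a collocation discretization, with $f_i(t,u)=\sum_{j=0}^N a_{ij}(t)B_j^i(u)$, of the kinetic system $$\partial_t f_i(t,u)=\sum_{h,k}\int_{D_h}\int_{D_k}\eta_{hk}(x,y)T_{hk}^i(x,y,u)f_h(t,x)f_k(t,y)\,dx\,dy-f_i(t,u)\sum_k\int_{D_k}\eta_{ik}(u,x)f_k(t,x)\,dx .$$ *)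

theory Defs
  imports "HOL-Analysis.Analysis" "HOL-Computational_Algebra.Polynomial"
begin

definition lagrange_basis :: "(nat \<Rightarrow> real) \<Rightarrow> nat \<Rightarrow> nat \<Rightarrow> real poly" where
  "lagrange_basis X N j = (\<Prod>k\<in>{0..N} - {j}. smult (1 / (X j - X k)) [:- X k, 1:])"

lemma poly_lagrange_basis:
  assumes "inj_on X {0..N}" "j \<in> {0..N}" "k \<in> {0..N}"
  shows "poly (lagrange_basis X N j) (X k) = (if j = k then 1 else 0)"
proof (cases "j = k")
  case True
  have "poly (smult (1 / (X k - X m)) [:- X m, 1:]) (X k) = 1" if "m \<in> {0..N} - {k}" for m
  proof -
    have "X k \<noteq> X m"
      using assms that by (auto dest: inj_onD)
    then show ?thesis
      by (simp add: divide_simps)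
  qed
  then show ?thesis
    using True unfolding lagrange_basis_def poly_prod
    by (simp add: prod.neutral del: poly_smult)
next
  case False
  then have "\<exists>m\<in>{0..N} - {j}. poly (smult (1 / (X j - X m)) [:- X m, 1:]) (X k) = 0"
    using assms(3) by (intro bexI[of _ k]) auto
  then show ?thesis
    using False by (simp add: lagrange_basis_def poly_prod prod_zero_iff del: poly_smult)
qed

lemma degree_lagrange_basis:
  assumes "j \<in> {0..N}"
  shows "degree (lagrange_basis X N j) \<le> N"
proof -
  have "degree (lagrange_basis X N j)
      \<le> (\<Sum>k\<in>{0..N} - {j}. degree (smult (1 / (X j - X k)) [:- X k, 1:]))"
    unfolding lagrange_basis_def
    using degree_prod_sum_le[of "{0..N} - {j}" "\<lambda>k. smult (1 / (X j - X k)) [:- X k, 1:]"]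
    by (simp add: o_def)
  also have "\<dots> \<le> (\<Sum>k\<in>{0..N} - {j}. 1)"
    by (rule sum_mono) simp
  also have "\<dots> = N"
    using assms by simp
  finally show ?thesis .
qed

definition has_set_integral :: "('a::euclidean_space \<Rightarrow> real) \<Rightarrow> 'a set \<Rightarrow> real \<Rightarrow> bool" where
  "has_set_integral f S c \<longleftrightarrow>
     set_integrable lborel S f \<and> (LINT z:S|lborel. f z) = c"

definition test_function :: "real set \<Rightarrow> (real \<Rightarrow> real) \<Rightarrow> bool" where
  "test_function U \<psi> \<longleftrightarrow>
     (\<forall>k v. (deriv ^^ k) \<psi> differentiable (at v)) \<and>
     compact (closure {v. \<psi> v \<noteq> 0}) \<and> closure {v. \<psi> v \<noteq> 0} \<subseteq> U"

text \<open>
  \<open>has_dirac_integral g \<phi> S E u c\<close> gives a meaning to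
  \<open>\<integral>\<integral>\<^sub>S g(x,y) \<delta>(\<phi>(x,y) - u) dx dy = c\<close>. As a function of \<open>u \<in> E\<close> the left-hand side is
  the distribution \<open>\<psi> \<mapsto> \<integral>\<integral>\<^sub>S g(x,y) \<psi>(\<phi>(x,y)) dx dy\<close>. Its value at the point \<open>u\<close> is \<open>c\<close>
  if near \<open>u\<close> it is represented by an integrable function \<open>G\<close> that is continuous at \<open>u\<close>
  relative to \<open>E\<close>, with \<open>G u = c\<close>. Continuity relative to \<open>E\<close> also gives the value at
  an endpoint of an interval \<open>E\<close>.
\<close>

definition has_dirac_integral ::
  "(real \<Rightarrow> real \<Rightarrow> real) \<Rightarrow> (real \<Rightarrow> real \<Rightarrow> real) \<Rightarrow> (real \<times> real) set \<Rightarrow> real set \<Rightarrow> real \<Rightarrow> real \<Rightarrow> bool"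
  where
  "has_dirac_integral g \<phi> S E u c \<longleftrightarrow>
     (\<exists>r>0. \<exists>G. continuous (at u within E) G \<and> G u = c \<and>
        set_integrable lborel (E \<inter> ball u r) G \<and>
        (\<forall>\<psi>. test_function (interior E \<inter> ball u r) \<psi> \<longrightarrow>
           has_set_integral (\<lambda>(x, y). g x y * \<psi> (\<phi> x y)) S
             (LINT v:E \<inter> ball u r|lborel. G v * \<psi> v)))"

text \<open>
  \<open>Regular T\<close> is a rate given by a function \<open>T(x,y,u)\<close>, and \<open>Dirac \<phi>\<close> is the rate
  \<open>\<delta>(\<phi>(x,y) - u)\<close>.
\<close>

datatype transition_rate =
    Regular "real \<Rightarrow> real \<Rightarrow> real \<Rightarrow> real"
  | Dirac "real \<Rightarrow> real \<Rightarrow> real"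

text \<open>
  In all coefficients below, \<open>D i\<close> is the domain of subsystem \<open>i\<close>, \<open>X i j\<close> its collocation
  points, \<open>\<eta> l m\<close> the encounter rates, and \<open>T i l m\<close> is the transition rate into subsystem
  \<open>i\<close> produced by an encounter of \<open>l\<close> with \<open>m\<close>.
  The double integral is taken over the product set, where absolute integrability makes it
  equal to the iterated one.
\<close>

definition has_gain_coeff ::
  "nat \<Rightarrow> (nat \<Rightarrow> real set) \<Rightarrow> (nat \<Rightarrow> nat \<Rightarrow> real) \<Rightarrow> (nat \<Rightarrow> nat \<Rightarrow> real \<Rightarrow> real \<Rightarrow> real) \<Rightarrow>
   (nat \<Rightarrow> nat \<Rightarrow> nat \<Rightarrow> transition_rate) \<Rightarrow>
   nat \<Rightarrow> nat \<Rightarrow> nat \<Rightarrow> nat \<Rightarrow> nat \<Rightarrow> nat \<Rightarrow> real \<Rightarrow> bool" where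
  "has_gain_coeff N D X \<eta> T i l m j p q c \<longleftrightarrow>
     (let Bp = poly (lagrange_basis (X l) N p); Bq = poly (lagrange_basis (X m) N q) in
      case T i l m of
        Regular \<tau> \<Rightarrow>
          has_set_integral (\<lambda>(x, y). \<eta> l m x y * \<tau> x y (X i j) * Bp x * Bq y) (D l \<times> D m) c
      | Dirac \<phi> \<Rightarrow>
          has_dirac_integral (\<lambda>x y. \<eta> l m x y * Bp x * Bq y) \<phi> (D l \<times> D m) (D i) (X i j) c)"

definition has_loss_coeff ::
  "nat \<Rightarrow> (nat \<Rightarrow> real set) \<Rightarrow> (nat \<Rightarrow> nat \<Rightarrow> real) \<Rightarrow> (nat \<Rightarrow> nat \<Rightarrow> real \<Rightarrow> real \<Rightarrow> real) \<Rightarrow>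
   nat \<Rightarrow> nat \<Rightarrow> nat \<Rightarrow> nat \<Rightarrow> real \<Rightarrow> bool" where
  "has_loss_coeff N D X \<eta> i j l q c \<longleftrightarrow>
     has_set_integral (\<lambda>y. \<eta> i l (X i j) y * poly (lagrange_basis (X l) N q) y) (D l) c"

definition has_weight ::
  "nat \<Rightarrow> (nat \<Rightarrow> real set) \<Rightarrow> (nat \<Rightarrow> nat \<Rightarrow> real) \<Rightarrow> nat \<Rightarrow> nat \<Rightarrow> real \<Rightarrow> bool" where
  "has_weight N D X i j c \<longleftrightarrow>
     has_set_integral (poly (lagrange_basis (X i) N j)) (D i) c"

definition gain_term ::
  "nat \<Rightarrow> nat \<Rightarrow> (nat \<Rightarrow> nat \<Rightarrow> nat \<Rightarrow> nat \<Rightarrow> nat \<Rightarrow> nat \<Rightarrow> real) \<Rightarrow> (nat \<Rightarrow> nat \<Rightarrow> real) \<Rightarrow>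
   nat \<Rightarrow> nat \<Rightarrow> real" where
  "gain_term n N Tc A i j =
     (\<Sum>l=1..n. \<Sum>m=1..n. \<Sum>p=0..N. \<Sum>q=0..N. Tc i l m j p q * A l p * A m q)"

definition loss_rate ::
  "nat \<Rightarrow> nat \<Rightarrow> (nat \<Rightarrow> nat \<Rightarrow> nat \<Rightarrow> nat \<Rightarrow> real) \<Rightarrow> (nat \<Rightarrow> nat \<Rightarrow> real) \<Rightarrow>
   nat \<Rightarrow> nat \<Rightarrow> real" where
  "loss_rate n N M A i j = (\<Sum>l=1..n. \<Sum>q=0..N. M i j l q * A l q)"

definition correction_denom ::
  "nat \<Rightarrow> nat \<Rightarrow> (nat \<Rightarrow> nat \<Rightarrow> nat \<Rightarrow> nat \<Rightarrow> real) \<Rightarrow> (nat \<Rightarrow> nat \<Rightarrow> real) \<Rightarrow>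
   (nat \<Rightarrow> nat \<Rightarrow> real) \<Rightarrow> real" where
  "correction_denom n N M w A = (\<Sum>i=1..n. \<Sum>j=0..N. A i j * w i j * loss_rate n N M A i j)"

definition correction ::
  "nat \<Rightarrow> nat \<Rightarrow> (nat \<Rightarrow> nat \<Rightarrow> nat \<Rightarrow> nat \<Rightarrow> nat \<Rightarrow> nat \<Rightarrow> real) \<Rightarrow>
   (nat \<Rightarrow> nat \<Rightarrow> nat \<Rightarrow> nat \<Rightarrow> real) \<Rightarrow> (nat \<Rightarrow> nat \<Rightarrow> real) \<Rightarrow> (nat \<Rightarrow> nat \<Rightarrow> real) \<Rightarrow> real" where
  "correction n N Tc M w A =
     (\<Sum>i=1..n. \<Sum>j=0..N. w i j * gain_term n N Tc A i j) / correction_denom n N M w A"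

definition discrete_mass ::
  "nat \<Rightarrow> nat \<Rightarrow> (nat \<Rightarrow> nat \<Rightarrow> real) \<Rightarrow> (nat \<Rightarrow> nat \<Rightarrow> real \<Rightarrow> real) \<Rightarrow> real \<Rightarrow> real" where
  "discrete_mass n N w a t = (\<Sum>i=1..n. \<Sum>j=0..N. a i j t * w i j)"

end

theory Submission
  imports Defs
begin

text \<open>
  The factor \<open>C\<close> is the quotient of the total weighted gain by the total weighted
  loss, so multiplying every loss term by \<open>C\<close> rescales the total loss to the total gain.
  Hence the weighted sum of the right-hand sides of the system vanishes whenever the
  denominator of \<open>C\<close> is nonzero (\<open>corrected_rates_balance\<close>). Since the mass is linear in
  the unknowns, this sum is its derivative along the solution.
\<close>

text \<open>
  \<open>C\<close> does not depend on \<open>(i, j)\<close>, so it factors out of the weighted loss, where it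
  cancels the denominator and leaves its numerator, the weighted gain.
\<close>

lemma corrected_rates_balance:
  assumes "correction_denom n N M w A \<noteq> 0"
  shows "(\<Sum>i=1..n. \<Sum>j=0..N.
            (gain_term n N Tc A i j - correction n N Tc M w A * A i j * loss_rate n N M A i j)
            * w i j) = 0"
proof -
  let ?C = "correction n N Tc M w A"
  have "(\<Sum>i=1..n. \<Sum>j=0..N. (gain_term n N Tc A i j - ?C * A i j * loss_rate n N M A i j) * w i j)
      = (\<Sum>i=1..n. \<Sum>j=0..N. w i j * gain_term n N Tc A i j) - ?C * correction_denom n N M w A"
    unfolding correction_denom_def
    by (simp add: sum_distrib_left sum_subtractf[symmetric] algebra_simps)
  also have "\<dots> = 0"
    using assms by (simp add: correction_def)
  finally show ?thesis .
qed

theorem proposition2: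
  fixes n N :: nat
    and D :: "nat \<Rightarrow> real set"
    and X :: "nat \<Rightarrow> nat \<Rightarrow> real"
    and \<eta> :: "nat \<Rightarrow> nat \<Rightarrow> real \<Rightarrow> real \<Rightarrow> real"
    and T :: "nat \<Rightarrow> nat \<Rightarrow> nat \<Rightarrow> transition_rate"
    and f0 :: "nat \<Rightarrow> real \<Rightarrow> real"
    and Tc :: "nat \<Rightarrow> nat \<Rightarrow> nat \<Rightarrow> nat \<Rightarrow> nat \<Rightarrow> nat \<Rightarrow> real"
    and M :: "nat \<Rightarrow> nat \<Rightarrow> nat \<Rightarrow> nat \<Rightarrow> real"
    and w :: "nat \<Rightarrow> nat \<Rightarrow> real"
    and J :: "real set"
    and a :: "nat \<Rightarrow> nat \<Rightarrow> real \<Rightarrow> real"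
  assumes "n \<ge> 1"
    and "\<And>i. i \<in> {1..n} \<Longrightarrow> is_interval (D i) \<and> D i \<subseteq> {0..}"
    and "\<And>i j. i \<in> {1..n} \<Longrightarrow> j \<in> {0..N} \<Longrightarrow> X i j \<in> D i"
    and "\<And>i. i \<in> {1..n} \<Longrightarrow> inj_on (X i) {0..N}"
    and "\<And>l m x y. l \<in> {1..n} \<Longrightarrow> m \<in> {1..n} \<Longrightarrow> x \<in> D l \<Longrightarrow> y \<in> D m \<Longrightarrow> 0 \<le> \<eta> l m x y"
    and "\<And>l m. l \<in> {1..n} \<Longrightarrow> m \<in> {1..n} \<Longrightarrow> \<exists>K. \<forall>x\<in>D l. \<forall>y\<in>D m. \<eta> l m x y \<le> K"
    and "\<And>i l m j p q. i \<in> {1..n} \<Longrightarrow> l \<in> {1..n} \<Longrightarrow> m \<in> {1..n} \<Longrightarrow>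
           j \<in> {0..N} \<Longrightarrow> p \<in> {0..N} \<Longrightarrow> q \<in> {0..N} \<Longrightarrow>
           has_gain_coeff N D X \<eta> T i l m j p q (Tc i l m j p q)"
    and "\<And>i j l q. i \<in> {1..n} \<Longrightarrow> j \<in> {0..N} \<Longrightarrow> l \<in> {1..n} \<Longrightarrow> q \<in> {0..N} \<Longrightarrow>
           has_loss_coeff N D X \<eta> i j l q (M i j l q)"
    and "\<And>i j. i \<in> {1..n} \<Longrightarrow> j \<in> {0..N} \<Longrightarrow> has_weight N D X i j (w i j)"
    and "is_interval J" and "0 \<in> J"
    and "\<And>i. i \<in> {1..n} \<Longrightarrow> set_integrable lborel (D i) (f0 i)"
    and "\<And>i j. i \<in> {1..n} \<Longrightarrow> j \<in> {0..N} \<Longrightarrow> a i j 0 = f0 i (X i j)"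
    and "\<And>t. t \<in> J \<Longrightarrow> correction_denom n N M w (\<lambda>i j. a i j t) \<noteq> 0"
    and "\<And>i j t. i \<in> {1..n} \<Longrightarrow> j \<in> {0..N} \<Longrightarrow> t \<in> J \<Longrightarrow>
           (a i j has_real_derivative
              gain_term n N Tc (\<lambda>i j. a i j t) i j
              - correction n N Tc M w (\<lambda>i j. a i j t) * a i j t
                * loss_rate n N M (\<lambda>i j. a i j t) i j) (at t within J)"
  shows "\<forall>t\<in>J. (discrete_mass n N w a has_real_derivative 0) (at t within J)"
proof
  fix t assume "t \<in> J"
  let ?A = "\<lambda>i j. a i j t"
  let ?rate = "\<lambda>i j. gain_term n N Tc ?A i j
                 - correction n N Tc M w ?A * ?A i j * loss_rate n N M ?A i j"
  have "((\<lambda>s. \<Sum>i=1..n. \<Sum>j=0..N. a i j s * w i j) has_real_derivative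
          (\<Sum>i=1..n. \<Sum>j=0..N. ?rate i j * w i j)) (at t within J)"
    using assms(15) \<open>t \<in> J\<close> by (intro DERIV_sum DERIV_cmult_right) auto
  moreover have "(\<Sum>i=1..n. \<Sum>j=0..N. ?rate i j * w i j) = 0"
    using assms(14) \<open>t \<in> J\<close> by (intro corrected_rates_balance)
  ultimately show "(discrete_mass n N w a has_real_derivative 0) (at t within J)"
    by (simp add: discrete_mass_def[abs_def])
qed

end
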